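(* Let $a,b,p,q$ be integers, let $(w_n)_{n\ge 0}$ be the Horadam sequence $w_0=a$, $w_1=b$, $w_n=pw_{n-1}+qw_{n-2}$ for $n\ge 2$, and let $\mathbb{O}G_n=w_ne_0+w_{n+1}e_1+\dots+w_{n+7}e_7$ be the $n$-th Horadam octonion. Then the generating function $g(t)=\sum_{n=0}^{\infty}\mathbb{O}G_n t^n$ is $$g(t)=\frac{\mathbb{O}G_0+(\mathbb{O}G_1-p\,\mathbb{O}G_0)t}{1-pt-qt^2}.$$
   Context: $\mathbb{O}$ is the eight-dimensional real octonion algebra with standard basis $e_0=1,e_1,\dots,e_7$; addition and scalar multiplication are componentwise. The generating function is a formal power series in $t$ with coefficients in $\mathbb{O}$ ($t$ commuting with all octonions), and division by $1-pt-qt^2$ means multiplication by its inverse in the formal power series ring $\mathbb{R}[[t]]$. *)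

theory Defs
  imports Complex_Main "HOL-Computational_Algebra.Formal_Power_Series"
begin

datatype octonion =
  Octonion (Oc0: real) (Oc1: real) (Oc2: real) (Oc3: real)
           (Oc4: real) (Oc5: real) (Oc6: real) (Oc7: real)

lemma octonion_eq_iff:
  "x = y \<longleftrightarrow> Oc0 x = Oc0 y \<and> Oc1 x = Oc1 y \<and> Oc2 x = Oc2 y \<and> Oc3 x = Oc3 y \<and>
             Oc4 x = Oc4 y \<and> Oc5 x = Oc5 y \<and> Oc6 x = Oc6 y \<and> Oc7 x = Oc7 y"
  by (cases x; cases y) simp

instantiation octonion :: real_vector
begin

definition "0 = Octonion 0 0 0 0 0 0 0 0"

definition "x + y =
  Octonion (Oc0 x + Oc0 y) (Oc1 x + Oc1 y) (Oc2 x + Oc2 y) (Oc3 x + Oc3 y)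
           (Oc4 x + Oc4 y) (Oc5 x + Oc5 y) (Oc6 x + Oc6 y) (Oc7 x + Oc7 y)"

definition "- x =
  Octonion (- Oc0 x) (- Oc1 x) (- Oc2 x) (- Oc3 x) (- Oc4 x) (- Oc5 x) (- Oc6 x) (- Oc7 x)"

definition "x - y = x + - (y :: octonion)"

definition "r *\<^sub>R x =
  Octonion (r * Oc0 x) (r * Oc1 x) (r * Oc2 x) (r * Oc3 x)
           (r * Oc4 x) (r * Oc5 x) (r * Oc6 x) (r * Oc7 x)"

instance
  by standard
    (simp_all add: octonion_eq_iff zero_octonion_def plus_octonion_def uminus_octonion_def
      minus_octonion_def scaleR_octonion_def algebra_simps)

end

text \<open>
  The product is fixed by $e_i e_j = e_k = - e_j e_i$ for the cyclic permutations $(i,j,k)$ of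
  $123, 145, 176, 246, 257, 347, 365$, together with $e_i^2 = -1$ for $i \ge 1$.  It is not
  associative, so the class \<open>real_algebra\<close> is not available.
\<close>

instantiation octonion :: "{one, times}"
begin

definition "1 = Octonion 1 0 0 0 0 0 0 0"

definition "x * y = (case x of Octonion x0 x1 x2 x3 x4 x5 x6 x7 \<Rightarrow>
  (case y of Octonion y0 y1 y2 y3 y4 y5 y6 y7 \<Rightarrow>
    Octonion
      (x0*y0 - x1*y1 - x2*y2 - x3*y3 - x4*y4 - x5*y5 - x6*y6 - x7*y7)
      (x0*y1 + x1*y0 + (x2*y3 - x3*y2) + (x4*y5 - x5*y4) + (x7*y6 - x6*y7))
      (x0*y2 + x2*y0 + (x3*y1 - x1*y3) + (x4*y6 - x6*y4) + (x5*y7 - x7*y5))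
      (x0*y3 + x3*y0 + (x1*y2 - x2*y1) + (x4*y7 - x7*y4) + (x6*y5 - x5*y6))
      (x0*y4 + x4*y0 + (x5*y1 - x1*y5) + (x6*y2 - x2*y6) + (x7*y3 - x3*y7))
      (x0*y5 + x5*y0 + (x1*y4 - x4*y1) + (x7*y2 - x2*y7) + (x3*y6 - x6*y3))
      (x0*y6 + x6*y0 + (x1*y7 - x7*y1) + (x2*y4 - x4*y2) + (x5*y3 - x3*y5))
      (x0*y7 + x7*y0 + (x6*y1 - x1*y6) + (x2*y5 - x5*y2) + (x3*y4 - x4*y3))))"

instance ..

end

lemmas octonion_defs =
  zero_octonion_def plus_octonion_def uminus_octonion_def minus_octonion_def
  scaleR_octonion_def one_octonion_def times_octonion_def

lemma octonion_distrib:
  fixes x y z :: octonion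
  shows "(x + y) * z = x * z + y * z" "x * (y + z) = x * y + x * z"
  by (cases x; cases y; cases z; simp add: octonion_defs algebra_simps)+

lemma octonion_scaleR_mult:
  fixes x y :: octonion
  shows "(r *\<^sub>R x) * y = r *\<^sub>R (x * y)" "x * (r *\<^sub>R y) = r *\<^sub>R (x * y)"
  by (cases x; cases y; simp add: octonion_defs algebra_simps)+

lemma octonion_mult_one:
  fixes x :: octonion
  shows "1 * x = x" "x * 1 = x" "0 * x = 0" "x * 0 = 0"
  by (cases x; simp add: octonion_defs)+

text \<open>Only the indices 0 to 7 are meaningful.\<close>

definition octonion_basis :: "nat \<Rightarrow> octonion" where
  "octonion_basis i =
    (let \<delta> = (\<lambda>j. if i = j then 1 else 0)
     in Octonion (\<delta> 0) (\<delta> 1) (\<delta> 2) (\<delta> 3) (\<delta> 4) (\<delta> 5) (\<delta> 6) (\<delta> 7))"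

lemma octonion_basis_0: "octonion_basis 0 = 1"
  by (simp add: octonion_basis_def one_octonion_def)

fun horadam :: "int \<Rightarrow> int \<Rightarrow> int \<Rightarrow> int \<Rightarrow> nat \<Rightarrow> int" where
  "horadam a b p q 0 = a"
| "horadam a b p q (Suc 0) = b"
| "horadam a b p q (Suc (Suc n)) = p * horadam a b p q (Suc n) + q * horadam a b p q n"

definition horadam_octonion :: "int \<Rightarrow> int \<Rightarrow> int \<Rightarrow> int \<Rightarrow> nat \<Rightarrow> octonion" where
  "horadam_octonion a b p q n =
    (\<Sum>i\<le>7. real_of_int (horadam a b p q (n + i)) *\<^sub>R octonion_basis i)"

text \<open>
  The action of $\mathbb{R}[[t]]$ on $\mathbb{O}[[t]]$ by the Cauchy product, with $t$ commuting
  with all octonions.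
\<close>

definition fps_scaleR :: "real fps \<Rightarrow> octonion fps \<Rightarrow> octonion fps" where
  "fps_scaleR f G = Abs_fps (\<lambda>n. \<Sum>i=0..n. fps_nth f i *\<^sub>R fps_nth G (n - i))"

lemma fps_scaleR_eq_mult:
  "fps_scaleR f G = Abs_fps (\<lambda>n. fps_nth f n *\<^sub>R 1) * G"
  by (rule fps_ext) (simp add: fps_scaleR_def fps_mult_nth octonion_scaleR_mult octonion_mult_one)

end

theory Submission
  imports Defs
begin

text \<open>
  Since the recurrence of $w_n$ passes to $\mathbb{O}G_n$, multiplying $g(t)$ by $1 - pt - qt^2$
  annihilates all coefficients from $t^2$ on. As $\mathbb{R}[[t]]$ acts on $\mathbb{O}[[t]]$ as on a
  module, this identity may be multiplied by the inverse of $1 - pt - qt^2$.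
\<close>

text \<open>Coordinate \<open>i\<close> carries the Horadam sequence shifted by \<open>i\<close>, so
  the recurrence holds coordinatewise.\<close>

lemma horadam_octonion_rec:
  "horadam_octonion a b p q (Suc (Suc n)) =
    real_of_int p *\<^sub>R horadam_octonion a b p q (Suc n) +
    real_of_int q *\<^sub>R horadam_octonion a b p q n"
  by (simp add: horadam_octonion_def scaleR_sum_right scaleR_add_left flip: sum.distrib)

lemma fps_scaleR_1: "fps_scaleR 1 G = G"
  by (rule fps_ext) (simp add: fps_scaleR_def if_distrib[of "\<lambda>r. r *\<^sub>R _"] sum.delta cong: if_cong)

text \<open>Both sides sum over index triples with total \<open>n\<close>; only real scalars are
  regrouped, never octonion products.\<close>

lemma fps_scaleR_mult: "fps_scaleR (f * g) G = fps_scaleR f (fps_scaleR g G)"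
proof (rule fps_ext)
  fix n
  have "fps_nth (fps_scaleR (f * g) G) n =
      (\<Sum>j=0..n. \<Sum>i=0..j. (fps_nth f i * fps_nth g (j - i)) *\<^sub>R fps_nth G (n - j))"
    by (simp add: fps_scaleR_def fps_mult_nth scaleR_sum_left)
  also have "\<dots> = (\<Sum>j=0..n. \<Sum>i=0..n-j. (fps_nth f j * fps_nth g i) *\<^sub>R fps_nth G (n - j - i))"
    by (rule fps_mult_assoc_lemma)
  also have "\<dots> = fps_nth (fps_scaleR f (fps_scaleR g G)) n"
    by (simp add: fps_scaleR_def scaleR_sum_right)
  finally show "fps_nth (fps_scaleR (f * g) G) n = fps_nth (fps_scaleR f (fps_scaleR g G)) n" .
qed

text \<open>
  The general lemmas on multiplication by \<^term>\<open>fps_X\<close> need an associative coefficient ring.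
\<close>

lemma fps_nth_octonion_const_mult_X:
  fixes x :: octonion
  shows "fps_nth (fps_const x * fps_X) n = (if n = 1 then x else 0)"
proof -
  have "fps_nth (fps_const x * fps_X) n = (\<Sum>i=0..n. if i = 0 then (if n = 1 then x else 0) else 0)"
    unfolding fps_mult_nth by (rule sum.cong) (auto simp: fps_X_def octonion_mult_one)
  then show ?thesis
    by simp
qed

lemma fps_nth_scaleR_quadratic:
  "fps_nth (fps_scaleR (1 - fps_const p * fps_X - fps_const q * fps_X ^ 2) G) n =
    fps_nth G n - (if n \<ge> 1 then p *\<^sub>R fps_nth G (n - 1) else 0)
      - (if n \<ge> 2 then q *\<^sub>R fps_nth G (n - 2) else 0)"
proof -
  \<comment> \<open>Each indicator sum collapses; the guards on \<open>n\<close> record whether 1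
    and 2 lie in the range.\<close>
  have "fps_nth (fps_scaleR (1 - fps_const p * fps_X - fps_const q * fps_X ^ 2) G) n =
      (\<Sum>i=0..n. (if i = 0 then fps_nth G n else 0) - (if i = 1 then p *\<^sub>R fps_nth G (n - 1) else 0)
        - (if i = 2 then q *\<^sub>R fps_nth G (n - 2) else 0))"
    unfolding fps_scaleR_def fps_nth_Abs_fps
    by (rule sum.cong) (auto simp: fps_X_power_nth)
  then show ?thesis
    by (simp add: sum_subtractf)
qed

theorem theorem3p2:
  fixes a b p q :: int
  shows "Abs_fps (\<lambda>n. horadam_octonion a b p q n) =
    fps_scaleR
      (inverse (1 - fps_const (real_of_int p) * fps_X - fps_const (real_of_int q) * fps_X ^ 2))
      (fps_const (horadam_octonion a b p q 0) +
       fps_const (horadam_octonion a b p q 1 - real_of_int p *\<^sub>R horadam_octonion a b p q 0) * fps_X)"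
    (is "?G = fps_scaleR (inverse ?D) ?N")
proof -
  have "fps_scaleR ?D ?G = ?N"
  proof (rule fps_ext)
    fix n
    \<comment> \<open>The numerator has degree at most 1; from 2 on the recurrence cancels
      everything.\<close>
    consider "n = 0" | "n = 1" | m where "n = Suc (Suc m)"
      by (metis One_nat_def not0_implies_Suc)
    then show "fps_nth (fps_scaleR ?D ?G) n = fps_nth ?N n"
      by cases (simp_all add: fps_nth_scaleR_quadratic fps_nth_octonion_const_mult_X
          horadam_octonion_rec octonion_mult_one)
  qed
  \<comment> \<open>The constant coefficient of \<open>?D\<close> is 1, hence nonzero.\<close>
  moreover have "inverse ?D * ?D = 1"
    by (rule inverse_mult_eq_1) simp
  ultimately show ?thesis
    by (metis fps_scaleR_1 fps_scaleR_mult)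
qed

end
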